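(* Let $A_R=[A,A]_{\mathsf{RadRng}}$ denote the radicalator of a skew brace $A$. The functor $\mathsf{SKB}\to\mathsf{RadRng}$ sending a skew brace $A$ to the quotient $A/A_R$ (and a homomorphism to the induced homomorphism on quotients) is left adjoint to the inclusion functor $\mathsf{RadRng}\to\mathsf{SKB}$, with unit given by the canonical quotient map $A\to A/A_R$. That is, $A/A_R$ is a radical ring, and every skew brace homomorphism from $A$ to a radical ring factors uniquely through $A\to A/A_R$.
   Context: A skew brace is a triple $(A,+,\circ)$ where $(A,+)$ and $(A,\circ)$ are groups such that $a\circ(b+c)=a\circ b-a+a\circ c$ for all $a,b,c\in A$. $\mathsf{SKB}$ is the category of skew braces and maps preserving both operations. With $a*b=-a+a\circ b-b$, an ideal of $A$ is a normal subgroup $I$ of $(A,+)$ with $a*x,x*a\in I$ for all $a\in A$, $x\in I$. The right distributor of $a,b,c\in A$ is $[a,b,c]=(a+b)\circ c-b\circ c+c-a\circ c$. The radicalator $A_R=[A,A]_{\mathsf{RadRng}}$ is the subgroup of $(A,+)$ generated by the elements $[a,b,c]$ and $a+b-a-b$ for all $a,b,c\in A$; it is an ideal of $A$. $\mathsf{RadRng}$, the category of radical rings, is identified with the full subcategory of $\mathsf{SKB}$ consisting of the skew braces satisfying the identities $(a+b)\circ c=a\circ c-c+b\circ c$ and $a+b=b+a$. *)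

theory Defs
  imports "HOL-Algebra.QuotRing" "HOL-Algebra.Generated_Groups"
begin

text \<open>
  A skew brace \<open>(A, +, \<circ>)\<close> is carried by the record of rings: \<open>\<oplus>\<close> is the (not necessarily
  commutative) operation \<open>+\<close>, and \<open>\<otimes>\<close> is the operation \<open>\<circ>\<close>. The fields \<open>\<zero>\<close> and \<open>\<one>\<close> are the
  neutral elements of the two groups; they coincide as a consequence of the axioms.
\<close>

locale skew_brace =
  fixes A (structure)
  assumes add_group: "group (add_monoid A)"
    and circ_group: "group A"
    and brace_distrib:
      "\<lbrakk>a \<in> carrier A; b \<in> carrier A; c \<in> carrier A\<rbrakk>
        \<Longrightarrow> a \<otimes> (b \<oplus> c) = a \<otimes> b \<ominus> a \<oplus> a \<otimes> c"

text \<open>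
  Radical rings, as skew braces: the operation \<open>\<otimes>\<close> is still the group operation \<open>\<circ>\<close> (the
  adjoint, or circle, operation), not the ring multiplication.
\<close>

locale radical_ring = skew_brace +
  assumes add_comm:
      "\<lbrakk>a \<in> carrier A; b \<in> carrier A\<rbrakk> \<Longrightarrow> a \<oplus> b = b \<oplus> a"
    and right_distrib:
      "\<lbrakk>a \<in> carrier A; b \<in> carrier A; c \<in> carrier A\<rbrakk>
        \<Longrightarrow> (a \<oplus> b) \<otimes> c = a \<otimes> c \<ominus> c \<oplus> b \<otimes> c"

text \<open>
  Morphisms are made extensional, so that equality of functions is equality of morphisms.
  Since radical rings form a full subcategory of skew braces, \<open>skb_hom\<close> also gives
  the morphisms between radical rings.
\<close>

definition skb_hom ::
    "('a, 'm) ring_scheme \<Rightarrow> ('b, 'n) ring_scheme \<Rightarrow> ('a \<Rightarrow> 'b) set" where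
  "skb_hom A B = hom (add_monoid A) (add_monoid B) \<inter> hom A B \<inter> extensional (carrier A)"

definition skb_id :: "('a, 'm) ring_scheme \<Rightarrow> 'a \<Rightarrow> 'a" where
  "skb_id A = (\<lambda>x\<in>carrier A. x)"

definition skb_star :: "('a, 'm) ring_scheme \<Rightarrow> 'a \<Rightarrow> 'a \<Rightarrow> 'a" where
  "skb_star A a b = (\<ominus>\<^bsub>A\<^esub> a) \<oplus>\<^bsub>A\<^esub> a \<otimes>\<^bsub>A\<^esub> b \<ominus>\<^bsub>A\<^esub> b"

definition skb_ideal :: "'a set \<Rightarrow> ('a, 'm) ring_scheme \<Rightarrow> bool" where
  "skb_ideal I A \<longleftrightarrow> I \<lhd> add_monoid A \<and>
     (\<forall>a\<in>carrier A. \<forall>x\<in>I. skb_star A a x \<in> I \<and> skb_star A x a \<in> I)"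

definition right_distributor :: "('a, 'm) ring_scheme \<Rightarrow> 'a \<Rightarrow> 'a \<Rightarrow> 'a \<Rightarrow> 'a" where
  "right_distributor A a b c =
     (a \<oplus>\<^bsub>A\<^esub> b) \<otimes>\<^bsub>A\<^esub> c \<ominus>\<^bsub>A\<^esub> b \<otimes>\<^bsub>A\<^esub> c \<oplus>\<^bsub>A\<^esub> c \<ominus>\<^bsub>A\<^esub> a \<otimes>\<^bsub>A\<^esub> c"

definition radicalator :: "('a, 'm) ring_scheme \<Rightarrow> 'a set" where
  "radicalator A = generate (add_monoid A)
     ({right_distributor A a b c | a b c.
          a \<in> carrier A \<and> b \<in> carrier A \<and> c \<in> carrier A} \<union>
      {a \<oplus>\<^bsub>A\<^esub> b \<ominus>\<^bsub>A\<^esub> a \<ominus>\<^bsub>A\<^esub> b | a b. a \<in> carrier A \<and> b \<in> carrier A})"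

text \<open>
  The library quotient \<open>Quot\<close> consists of the additive cosets; its definition makes
  sense for this record without the ring axioms: the product of \<open>I + a\<close> and \<open>I + b\<close> is the
  coset \<open>I + a \<circ> b\<close> whenever \<open>I\<close> is an ideal of the skew brace.
\<close>

definition rad_quot :: "('a, 'm) ring_scheme \<Rightarrow> 'a set ring" where
  "rad_quot A = A Quot radicalator A"

definition rad_proj :: "('a, 'm) ring_scheme \<Rightarrow> 'a \<Rightarrow> 'a set" where
  "rad_proj A = (\<lambda>x\<in>carrier A. radicalator A +>\<^bsub>A\<^esub> x)"

text \<open>
  The map induced by \<open>f\<close> on quotients sends the class of \<open>x\<close> to the class of \<open>f x\<close>, the only
  element of the image below when \<open>f\<close> is a homomorphism.
\<close>

definition rad_map ::
    "('a, 'm) ring_scheme \<Rightarrow> ('b, 'n) ring_scheme \<Rightarrow> ('a \<Rightarrow> 'b) \<Rightarrow> 'a set \<Rightarrow> 'b set" where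
  "rad_map A B f = (\<lambda>X\<in>carrier (rad_quot A). the_elem ((\<lambda>x. rad_proj B (f x)) ` X))"

definition rad_transpose :: "('a, 'm) ring_scheme \<Rightarrow> ('a set \<Rightarrow> 'r) \<Rightarrow> 'a \<Rightarrow> 'r" where
  "rad_transpose A g = compose (carrier A) g (rad_proj A)"

end

theory Submission
  imports Defs
begin

text \<open>
  Write \<open>\<lambda>\<^sub>a(b) = -a + a \<circ> b\<close> and \<open>I\<close> for the radicalator. Modulo \<open>I\<close> addition is commutative, and the
  right distributor \<open>[a,b,c]\<close> is \<open>(a + b) * c - a * c - b * c\<close>; so \<open>a * b\<close> is biadditive modulo \<open>I\<close>.
  A biadditive map kills \<open>I\<close> in either variable as soon as it kills the right distributors, which
  follows from expanding \<open>(x \<circ> y) * z\<close> and \<open>x * (y \<circ> z)\<close>. Hence \<open>I\<close> is an ideal, and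
  \<open>a \<circ> b = a + a * b + b\<close> modulo \<open>I\<close> is well defined on cosets and right distributive.
\<close>

text \<open>The library sets up the method \<open>algebra\<close> for rings only.\<close>

lemmas (in abelian_group) abelian_group_simprules
  [algebra abelian_group "zero G" "add G" "a_inv G" "a_minus G"] =
  a_closed zero_closed a_inv_closed minus_closed
  a_assoc l_zero l_neg a_comm minus_eq
  r_zero r_neg r_neg2 r_neg1 minus_add minus_minus minus_zero a_lcomm

lemma (in abelian_group) minus_eq_zero_iff:
  "\<lbrakk>x \<in> carrier G; y \<in> carrier G\<rbrakk> \<Longrightarrow> x \<ominus> y = \<zero> \<longleftrightarrow> x = y"
  by (metis a_inv_closed minus_eq minus_equality minus_minus r_neg)

section \<open>The two groups of a skew brace, and the maps \<lambda> and star\<close>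

sublocale skew_brace < add: group "add_monoid A"
  rewrites "carrier (add_monoid A) = carrier A"
    and "mult (add_monoid A) = add A"
    and "one (add_monoid A) = zero A"
    and "m_inv (add_monoid A) = a_inv A"
  by (rule add_group) (auto simp: a_inv_def)

sublocale skew_brace < circ: group A
  by (rule circ_group)

text \<open>The lambda map of the skew brace: \<open>a \<mapsto> \<lambda>\<^sub>a\<close> is the
  action of the circle group on the additive group by automorphisms.\<close>

definition skb_lambda :: "('a, 'm) ring_scheme \<Rightarrow> 'a \<Rightarrow> 'a \<Rightarrow> 'a" where
  "skb_lambda A a b = (\<ominus>\<^bsub>A\<^esub> a) \<oplus>\<^bsub>A\<^esub> a \<otimes>\<^bsub>A\<^esub> b"

context skew_brace
begin

lemma minus_closed [intro, simp]:
  "\<lbrakk>x \<in> carrier A; y \<in> carrier A\<rbrakk> \<Longrightarrow> x \<ominus> y \<in> carrier A"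
  by (simp add: a_minus_def)

lemma l_cancel_neg [simp]:
  assumes "x \<in> carrier A" "y \<in> carrier A"
  shows "\<ominus> x \<oplus> (x \<oplus> y) = y" "x \<oplus> (\<ominus> x \<oplus> y) = y"
  using assms by (simp_all add: add.m_assoc [symmetric])

lemma lambda_closed [intro, simp]:
  "\<lbrakk>a \<in> carrier A; b \<in> carrier A\<rbrakk> \<Longrightarrow> skb_lambda A a b \<in> carrier A"
  by (simp add: skb_lambda_def)

lemma star_closed [intro, simp]:
  "\<lbrakk>a \<in> carrier A; b \<in> carrier A\<rbrakk> \<Longrightarrow> skb_star A a b \<in> carrier A"
  by (simp add: skb_star_def)

lemma star_lambda: "skb_star A a b = skb_lambda A a b \<ominus> b"
  by (simp add: skb_star_def skb_lambda_def)

lemma lambda_star: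
  "\<lbrakk>a \<in> carrier A; b \<in> carrier A\<rbrakk> \<Longrightarrow> skb_lambda A a b = skb_star A a b \<oplus> b"
  by (simp add: star_lambda a_minus_def add.m_assoc)

lemma circ_lambda:
  "\<lbrakk>a \<in> carrier A; b \<in> carrier A\<rbrakk> \<Longrightarrow> a \<otimes> b = a \<oplus> skb_lambda A a b"
  by (simp add: skb_lambda_def)

text \<open>This is the brace axiom with \<open>\<ominus> a\<close> added on the left.\<close>

lemma lambda_add:
  "\<lbrakk>a \<in> carrier A; b \<in> carrier A; c \<in> carrier A\<rbrakk>
    \<Longrightarrow> skb_lambda A a (b \<oplus> c) = skb_lambda A a b \<oplus> skb_lambda A a c"
  by (simp add: skb_lambda_def brace_distrib a_minus_def add.m_assoc)

text \<open>Apply \<open>\<lambda>\<^sub>a\<close> to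
  \<open>b \<otimes> c = b \<oplus> \<lambda>\<^sub>b(c)\<close> and add \<open>a\<close> on the
  left; associativity of \<open>\<otimes>\<close> turns the left side into
  \<open>a \<otimes> b \<otimes> c\<close>, and cancelling \<open>a \<otimes> b\<close> leaves the
  claim.\<close>

lemma lambda_circ:
  assumes "a \<in> carrier A" "b \<in> carrier A" "c \<in> carrier A"
  shows "skb_lambda A (a \<otimes> b) c = skb_lambda A a (skb_lambda A b c)"
proof -
  have "skb_lambda A a (b \<otimes> c) = skb_lambda A a b \<oplus> skb_lambda A a (skb_lambda A b c)"
    using assms by (simp add: circ_lambda [of b c] lambda_add)
  then have "a \<oplus> skb_lambda A a (b \<otimes> c)
      = (a \<oplus> skb_lambda A a b) \<oplus> skb_lambda A a (skb_lambda A b c)"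
    using assms by (simp add: add.m_assoc)
  then have "a \<otimes> b \<otimes> c = a \<otimes> b \<oplus> skb_lambda A a (skb_lambda A b c)"
    using assms by (simp add: circ.m_assoc flip: circ_lambda)
  then show ?thesis
    using assms by (simp add: skb_lambda_def [of A "a \<otimes> b"])
qed

section \<open>The radicalator as a normal subgroup, and a criterion for vanishing on it\<close>

lemma right_distributor_closed [intro, simp]:
  "\<lbrakk>a \<in> carrier A; b \<in> carrier A; c \<in> carrier A\<rbrakk> \<Longrightarrow> right_distributor A a b c \<in> carrier A"
  by (simp add: right_distributor_def)

lemma radicalator_subgroup: "subgroup (radicalator A) (add_monoid A)"
  unfolding radicalator_def
  by (rule group.generate_is_subgroup [OF add_group]) auto

lemma commutator_in_radicalator:
  "\<lbrakk>a \<in> carrier A; b \<in> carrier A\<rbrakk> \<Longrightarrow> a \<oplus> b \<ominus> a \<ominus> b \<in> radicalator A"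
  unfolding radicalator_def by (rule generate.incl) blast

lemma right_distributor_in_radicalator:
  "\<lbrakk>a \<in> carrier A; b \<in> carrier A; c \<in> carrier A\<rbrakk>
    \<Longrightarrow> right_distributor A a b c \<in> radicalator A"
  unfolding radicalator_def by (rule generate.incl) blast

lemma radicalator_closed [simp]: "x \<in> radicalator A \<Longrightarrow> x \<in> carrier A"
  using subgroup.subset [OF radicalator_subgroup] by auto

lemma radicalator_normal: "radicalator A \<lhd> add_monoid A"
proof -
  have "x \<oplus> h \<ominus> x \<in> radicalator A" if "x \<in> carrier A" "h \<in> radicalator A" for x h
  proof -
    \<comment> \<open>The conjugate of \<open>h\<close> by \<open>x\<close> is their commutator, a
      generator, followed by \<open>h\<close>.\<close>
    have "(x \<oplus> h \<ominus> x \<ominus> h) \<oplus> h \<in> radicalator A"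
      using subgroup.m_closed [OF radicalator_subgroup] commutator_in_radicalator that by simp
    then show ?thesis
      using that by (simp add: a_minus_def add.m_assoc)
  qed
  then show ?thesis
    using radicalator_subgroup
    by (simp add: group.normal_inv_iff [OF add_group] a_minus_def a_inv_def)
qed

text \<open>An abelian target kills commutators, so only the right distributors remain to be checked
  on the generators. It serves for star in each variable and for homomorphisms into radical
  rings.\<close>

lemma hom_vanishes_on_radicalator:
  fixes G (structure)
  assumes "abelian_group G" "f \<in> hom (add_monoid A) (add_monoid G)"
    and dist: "\<And>a b c. \<lbrakk>a \<in> carrier A; b \<in> carrier A; c \<in> carrier A\<rbrakk>
      \<Longrightarrow> f (right_distributor A a b c) = \<zero>\<^bsub>G\<^esub>"
    and "x \<in> radicalator A"
  shows "f x = \<zero>\<^bsub>G\<^esub>"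
proof -
  interpret G: abelian_group G by fact
  interpret f: group_hom "add_monoid A" "add_monoid G" f
    using assms(2) add_group G.a_group by (simp add: group_hom_def group_hom_axioms_def)
  have f_closed: "f x \<in> carrier G" if "x \<in> carrier A" for x
    using f.hom_closed that by simp
  have f_add: "f (x \<oplus>\<^bsub>A\<^esub> y) = f x \<oplus>\<^bsub>G\<^esub> f y" if "x \<in> carrier A" "y \<in> carrier A" for x y
    using f.hom_mult that by simp
  have f_inv: "f (\<ominus>\<^bsub>A\<^esub> x) = \<ominus>\<^bsub>G\<^esub> f x" if "x \<in> carrier A" for x
    using f.hom_inv that by (simp add: a_inv_def)
  have comm: "f (a \<oplus>\<^bsub>A\<^esub> b \<ominus>\<^bsub>A\<^esub> a \<ominus>\<^bsub>A\<^esub> b) = \<zero>\<^bsub>G\<^esub>"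
    if "a \<in> carrier A" "b \<in> carrier A" for a b
  proof -
    have "f a \<in> carrier G" "f b \<in> carrier G"
      using that by (auto intro: f_closed)
    then have "f a \<oplus>\<^bsub>G\<^esub> f b \<oplus>\<^bsub>G\<^esub> (\<ominus>\<^bsub>G\<^esub> f a) \<oplus>\<^bsub>G\<^esub> (\<ominus>\<^bsub>G\<^esub> f b) = \<zero>\<^bsub>G\<^esub>"
      by algebra
    then show ?thesis
      using that by (simp add: a_minus_def f_add f_inv)
  qed
  let ?K = "kernel (add_monoid A) (add_monoid G) f"
  have "radicalator A \<subseteq> ?K"
    unfolding radicalator_def
  proof (rule group.generate_subgroup_incl [OF add_group _ f.subgroup_kernel], safe)
    fix a b c assume "a \<in> carrier A" "b \<in> carrier A" "c \<in> carrier A"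
    then show "right_distributor A a b c \<in> ?K"
      by (simp add: kernel_def dist)
  next
    fix a b assume "a \<in> carrier A" "b \<in> carrier A"
    then show "a \<oplus>\<^bsub>A\<^esub> b \<ominus>\<^bsub>A\<^esub> a \<ominus>\<^bsub>A\<^esub> b \<in> ?K"
      by (simp add: kernel_def comm)
  qed
  then show ?thesis
    using assms(4) by (auto simp: kernel_def)
qed

section \<open>The additive group of the quotient\<close>

lemma rad_quot_simps:
  "carrier (rad_quot A) = (\<lambda>x. radicalator A +> x) ` carrier A"
  "\<zero>\<^bsub>rad_quot A\<^esub> = radicalator A"
  "\<one>\<^bsub>rad_quot A\<^esub> = radicalator A +> \<one>"
  by (auto simp: rad_quot_def FactRing_def A_RCOSETS_def')

lemma coset_closed [intro, simp]: "x \<in> carrier A \<Longrightarrow> radicalator A +> x \<in> carrier (rad_quot A)"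
  by (simp add: rad_quot_simps)

lemma coset_add:
  "\<lbrakk>x \<in> carrier A; y \<in> carrier A\<rbrakk>
    \<Longrightarrow> radicalator A +> (x \<oplus> y) = (radicalator A +> x) \<oplus>\<^bsub>rad_quot A\<^esub> (radicalator A +> y)"
  using normal.rcos_sum [OF radicalator_normal]
  by (simp add: rad_quot_def FactRing_def a_r_coset_def set_add_def)

lemma coset_self: "x \<in> carrier A \<Longrightarrow> x \<in> radicalator A +> x"
  using group.rcos_self [OF add_group _ radicalator_subgroup] by (simp add: a_r_coset_def)

lemma in_coset_iff:
  "\<lbrakk>x \<in> carrier A\<rbrakk> \<Longrightarrow> y \<in> radicalator A +> x
     \<longleftrightarrow> y \<in> carrier A \<and> radicalator A +> y = radicalator A +> x"
  using group.repr_independence [OF add_group _ _ radicalator_subgroup, of y x] coset_self [of y]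
  by (auto simp: a_r_coset_def r_coset_def)

lemma coset_eq_zero_iff:
  "x \<in> carrier A \<Longrightarrow> radicalator A +> x = \<zero>\<^bsub>rad_quot A\<^esub> \<longleftrightarrow> x \<in> radicalator A"
  using group.coset_join1 [OF add_group _ _ radicalator_subgroup, of x]
    group.coset_join2 [OF add_group _ radicalator_subgroup, of x]
  by (auto simp: a_r_coset_def rad_quot_simps)

lemma rad_quot_abelian: "abelian_group (rad_quot A)"
proof (rule comm_group_abelian_groupI, rule group.group_comm_groupI)
  have "add_monoid (rad_quot A) = add_monoid A Mod radicalator A"
    by (simp add: rad_quot_def FactRing_def FactGroup_def A_RCOSETS_def set_add_def)
  then show "group (add_monoid (rad_quot A))"
    using normal.factorgroup_is_group [OF radicalator_normal] by simp
  fix X Y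
  assume "X \<in> carrier (add_monoid (rad_quot A))" "Y \<in> carrier (add_monoid (rad_quot A))"
  then obtain x y where xy: "x \<in> carrier A" "y \<in> carrier A"
    and X: "X = radicalator A +> x" and Y: "Y = radicalator A +> y"
    by (auto simp: rad_quot_simps)
  \<comment> \<open>The two sums differ by a commutator, which lies in I, so their cosets
    agree.\<close>
  have "x \<oplus> y = (x \<oplus> y \<ominus> x \<ominus> y) \<oplus> (y \<oplus> x)"
    using xy by (simp add: a_minus_def add.m_assoc)
  then have "x \<oplus> y \<in> radicalator A +> (y \<oplus> x)"
    using commutator_in_radicalator xy by (auto simp: a_r_coset_def r_coset_def)
  then have "radicalator A +> (x \<oplus> y) = radicalator A +> (y \<oplus> x)"
    using xy by (subst (asm) in_coset_iff) auto
  then show "X \<otimes>\<^bsub>add_monoid (rad_quot A)\<^esub> Y = Y \<otimes>\<^bsub>add_monoid (rad_quot A)\<^esub> X"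
    using xy by (simp add: X Y coset_add)
qed

end

text \<open>From here on, identities between classes are settled by \<open>algebra\<close> once
  their atoms are known to lie in the carrier.\<close>

sublocale skew_brace < Q: abelian_group "rad_quot A"
  by (rule rad_quot_abelian)

section \<open>Star modulo the radicalator\<close>

context skew_brace
begin

lemma coset_hom: "(\<lambda>x. radicalator A +> x) \<in> hom (add_monoid A) (add_monoid (rad_quot A))"
  by (simp add: hom_def coset_add)

text \<open>Stated for any additive map into the quotient because it is applied to the coset map and
  to star in each variable.\<close>

lemma hom_rad_quot_diff:
  assumes "h \<in> hom (add_monoid A) (add_monoid (rad_quot A))" "x \<in> carrier A" "y \<in> carrier A"
  shows "h (x \<ominus> y) = h x \<ominus>\<^bsub>rad_quot A\<^esub> h y"
proof -
  have "h (\<ominus> y) = \<ominus>\<^bsub>rad_quot A\<^esub> h y"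
    using assms group_hom.hom_inv [of "add_monoid A" "add_monoid (rad_quot A)" h y]
      add_group Q.a_group
    by (simp add: group_hom_def group_hom_axioms_def a_inv_def)
  then show ?thesis
    using assms by (simp add: a_minus_def hom_def)
qed

lemma coset_diff:
  "\<lbrakk>x \<in> carrier A; y \<in> carrier A\<rbrakk>
    \<Longrightarrow> radicalator A +> (x \<ominus> y) = (radicalator A +> x) \<ominus>\<^bsub>rad_quot A\<^esub> (radicalator A +> y)"
  by (rule hom_rad_quot_diff [OF coset_hom])

text \<open>Its arguments are elements, not classes: independence of representatives,
  \<open>coset_star_cong\<close>, rests on I being absorbed by star on both sides.\<close>

definition coset_star :: "'a \<Rightarrow> 'a \<Rightarrow> 'a set" where
  "coset_star x y = radicalator A +> skb_star A x y"

lemma coset_star_closed [intro, simp]: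
  "\<lbrakk>x \<in> carrier A; y \<in> carrier A\<rbrakk> \<Longrightarrow> coset_star x y \<in> carrier (rad_quot A)"
  by (simp add: coset_star_def)

lemma coset_lambda:
  "\<lbrakk>x \<in> carrier A; y \<in> carrier A\<rbrakk>
    \<Longrightarrow> radicalator A +> skb_lambda A x y = coset_star x y \<oplus>\<^bsub>rad_quot A\<^esub> (radicalator A +> y)"
  by (simp add: coset_star_def lambda_star coset_add)

text \<open>Trades \<open>\<otimes>\<close> for sums and star, so that facts about the circle
  operation become identities in an abelian group.\<close>

lemma coset_circ:
  "\<lbrakk>x \<in> carrier A; y \<in> carrier A\<rbrakk>
    \<Longrightarrow> radicalator A +> (x \<otimes> y)
      = (radicalator A +> x) \<oplus>\<^bsub>rad_quot A\<^esub> (coset_star x y \<oplus>\<^bsub>rad_quot A\<^esub> (radicalator A +> y))"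
  by (simp add: circ_lambda coset_add coset_lambda)

text \<open>Star is \<open>\<lambda>\<^sub>x(y) - y\<close>, and \<open>\<lambda>\<^sub>x\<close> is
  additive; commutativity of the quotient regroups the terms.\<close>

lemma coset_star_add_right:
  assumes "x \<in> carrier A" "y \<in> carrier A" "z \<in> carrier A"
  shows "coset_star x (y \<oplus> z) = coset_star x y \<oplus>\<^bsub>rad_quot A\<^esub> coset_star x z"
proof -
  note closed = coset_closed [OF assms(2)] coset_closed [OF assms(3)]
    coset_star_closed [OF assms(1,2)] coset_star_closed [OF assms(1,3)]
  have "coset_star x (y \<oplus> z) = radicalator A +> (skb_lambda A x y \<oplus> skb_lambda A x z \<ominus> (y \<oplus> z))"
    using assms by (simp add: coset_star_def star_lambda lambda_add)
  also have "\<dots> = coset_star x y \<oplus>\<^bsub>rad_quot A\<^esub> (radicalator A +> y)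
      \<oplus>\<^bsub>rad_quot A\<^esub> (coset_star x z \<oplus>\<^bsub>rad_quot A\<^esub> (radicalator A +> z))
      \<ominus>\<^bsub>rad_quot A\<^esub> ((radicalator A +> y) \<oplus>\<^bsub>rad_quot A\<^esub> (radicalator A +> z))"
    using assms by (simp add: coset_diff coset_add coset_lambda)
  also have "\<dots> = coset_star x y \<oplus>\<^bsub>rad_quot A\<^esub> coset_star x z"
    using closed by algebra
  finally show ?thesis .
qed

text \<open>In the abelian quotient the class of \<open>right_distributor A x y z\<close> simplifies
  to the defect of additivity, and it is zero because the distributor is a generator of I.\<close>

lemma coset_star_add_left:
  assumes "x \<in> carrier A" "y \<in> carrier A" "z \<in> carrier A"
  shows "coset_star (x \<oplus> y) z = coset_star x z \<oplus>\<^bsub>rad_quot A\<^esub> coset_star y z"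
proof -
  have xy: "x \<oplus> y \<in> carrier A"
    using assms by simp
  note closed = assms [THEN coset_closed] coset_star_closed [OF xy assms(3)]
    coset_star_closed [OF assms(1,3)] coset_star_closed [OF assms(2,3)]
  have "radicalator A +> right_distributor A x y z =
      (radicalator A +> x) \<oplus>\<^bsub>rad_quot A\<^esub> (radicalator A +> y)
        \<oplus>\<^bsub>rad_quot A\<^esub> (coset_star (x \<oplus> y) z \<oplus>\<^bsub>rad_quot A\<^esub> (radicalator A +> z))
      \<ominus>\<^bsub>rad_quot A\<^esub> ((radicalator A +> y)
        \<oplus>\<^bsub>rad_quot A\<^esub> (coset_star y z \<oplus>\<^bsub>rad_quot A\<^esub> (radicalator A +> z)))
      \<oplus>\<^bsub>rad_quot A\<^esub> (radicalator A +> z)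
      \<ominus>\<^bsub>rad_quot A\<^esub> ((radicalator A +> x)
        \<oplus>\<^bsub>rad_quot A\<^esub> (coset_star x z \<oplus>\<^bsub>rad_quot A\<^esub> (radicalator A +> z)))"
    using assms by (simp add: right_distributor_def coset_diff coset_add coset_circ)
  also have "\<dots> = coset_star (x \<oplus> y) z
      \<ominus>\<^bsub>rad_quot A\<^esub> (coset_star x z \<oplus>\<^bsub>rad_quot A\<^esub> coset_star y z)"
    using closed by algebra
  also have "radicalator A +> right_distributor A x y z = \<zero>\<^bsub>rad_quot A\<^esub>"
    using assms coset_eq_zero_iff right_distributor_in_radicalator by simp
  finally show ?thesis
    using closed by (metis Q.add.m_closed Q.minus_eq_zero_iff)
qed

lemma coset_star_hom_right:
  "x \<in> carrier A \<Longrightarrow> (\<lambda>y. coset_star x y) \<in> hom (add_monoid A) (add_monoid (rad_quot A))"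
  by (simp add: hom_def coset_star_add_right)

lemma coset_star_hom_left:
  "y \<in> carrier A \<Longrightarrow> (\<lambda>x. coset_star x y) \<in> hom (add_monoid A) (add_monoid (rad_quot A))"
  by (simp add: hom_def coset_star_add_left)

lemma coset_star_diff_right:
  "\<lbrakk>x \<in> carrier A; y \<in> carrier A; z \<in> carrier A\<rbrakk>
    \<Longrightarrow> coset_star x (y \<ominus> z) = coset_star x y \<ominus>\<^bsub>rad_quot A\<^esub> coset_star x z"
  by (rule hom_rad_quot_diff [OF coset_star_hom_right])

lemma coset_star_diff_left:
  "\<lbrakk>x \<in> carrier A; y \<in> carrier A; z \<in> carrier A\<rbrakk>
    \<Longrightarrow> coset_star (x \<ominus> y) z = coset_star x z \<ominus>\<^bsub>rad_quot A\<^esub> coset_star y z"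
  by (rule hom_rad_quot_diff [OF coset_star_hom_left])

text \<open>From \<open>\<lambda>\<^sub>x\<^sub>\<circ>\<^sub>y = \<lambda>\<^sub>x
  \<lambda>\<^sub>y\<close>: with \<open>w = \<lambda>\<^sub>y(z)\<close>, the difference
  \<open>\<lambda>\<^sub>x(w) - z\<close> splits as
  \<open>(\<lambda>\<^sub>x(w) - w) + (w - z)\<close>.\<close>

lemma coset_star_circ_left:
  assumes "x \<in> carrier A" "y \<in> carrier A" "z \<in> carrier A"
  shows "coset_star (x \<otimes> y) z
    = coset_star x (skb_lambda A y z) \<oplus>\<^bsub>rad_quot A\<^esub> coset_star y z"
proof -
  have "skb_lambda A y z \<in> carrier A"
    using assms by simp
  note closed = coset_closed [OF assms(3)] coset_star_closed [OF assms(2,3)]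
    coset_star_closed [OF assms(1) this]
  have "coset_star (x \<otimes> y) z = radicalator A +> (skb_lambda A x (skb_lambda A y z) \<ominus> z)"
    using assms by (simp add: coset_star_def star_lambda lambda_circ)
  also have "\<dots> = coset_star x (skb_lambda A y z)
      \<oplus>\<^bsub>rad_quot A\<^esub> (coset_star y z \<oplus>\<^bsub>rad_quot A\<^esub> (radicalator A +> z))
      \<ominus>\<^bsub>rad_quot A\<^esub> (radicalator A +> z)"
    using assms by (simp add: coset_diff coset_lambda)
  also have "\<dots> = coset_star x (skb_lambda A y z) \<oplus>\<^bsub>rad_quot A\<^esub> coset_star y z"
    using closed by algebra
  finally show ?thesis .
qed

text \<open>
  The two expansions of \<open>(x \<circ> y) * z\<close>, by \<open>\<lambda>\<^sub>x\<^sub>\<circ>\<^sub>y = \<lambda>\<^sub>x \<lambda>\<^sub>y\<close> and by \<open>x \<circ> y = x + \<lambda>\<^sub>x(y)\<close>, determine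
  the class of \<open>x * \<lambda>\<^sub>y(z)\<close>.
\<close>

lemma coset_star_circ_right:
  assumes "x \<in> carrier A" "y \<in> carrier A" "z \<in> carrier A"
  shows "coset_star x (y \<otimes> z)
    = coset_star x y \<oplus>\<^bsub>rad_quot A\<^esub> coset_star x z
        \<oplus>\<^bsub>rad_quot A\<^esub> coset_star (skb_lambda A x y) z \<ominus>\<^bsub>rad_quot A\<^esub> coset_star y z"
proof -
  have "skb_lambda A y z \<in> carrier A" "skb_lambda A x y \<in> carrier A"
    using assms by simp_all
  note closed = coset_star_closed [OF assms(1,2)] coset_star_closed [OF assms(2,3)]
    coset_star_closed [OF assms(1,3)]
    coset_star_closed [OF assms(1) this(1)] coset_star_closed [OF this(2) assms(3)]
  have eq: "coset_star x (skb_lambda A y z) \<oplus>\<^bsub>rad_quot A\<^esub> coset_star y z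
      = coset_star x z \<oplus>\<^bsub>rad_quot A\<^esub> coset_star (skb_lambda A x y) z"
    using assms coset_star_circ_left [of x y z]
    by (simp add: circ_lambda [of x y] coset_star_add_left)
  have "coset_star x (skb_lambda A y z)
      = (coset_star x (skb_lambda A y z) \<oplus>\<^bsub>rad_quot A\<^esub> coset_star y z)
        \<ominus>\<^bsub>rad_quot A\<^esub> coset_star y z"
    using closed by algebra
  also have "\<dots> = (coset_star x z \<oplus>\<^bsub>rad_quot A\<^esub> coset_star (skb_lambda A x y) z)
        \<ominus>\<^bsub>rad_quot A\<^esub> coset_star y z"
    by (simp only: eq)
  finally have "coset_star x (y \<otimes> z) = coset_star x y \<oplus>\<^bsub>rad_quot A\<^esub>
      ((coset_star x z \<oplus>\<^bsub>rad_quot A\<^esub> coset_star (skb_lambda A x y) z)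
        \<ominus>\<^bsub>rad_quot A\<^esub> coset_star y z)"
    using assms by (simp add: circ_lambda [of y z] coset_star_add_right)
  also have "\<dots> = coset_star x y \<oplus>\<^bsub>rad_quot A\<^esub> coset_star x z
        \<oplus>\<^bsub>rad_quot A\<^esub> coset_star (skb_lambda A x y) z \<ominus>\<^bsub>rad_quot A\<^esub> coset_star y z"
    using closed by algebra
  finally show ?thesis .
qed

section \<open>The radicalator is an ideal\<close>

lemma coset_star_radicalator_left:
  assumes "x \<in> radicalator A" "a \<in> carrier A"
  shows "coset_star x a = \<zero>\<^bsub>rad_quot A\<^esub>"
proof (rule hom_vanishes_on_radicalator [OF rad_quot_abelian coset_star_hom_left _ assms(1)])
  fix p q r assume pqr: "p \<in> carrier A" "q \<in> carrier A" "r \<in> carrier A"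
  \<comment> \<open>Expanding \<open>(u \<otimes> r) * a\<close> by
    \<open>coset_star_circ_left\<close> gives \<open>u * t + r * a\<close> with the same
    \<open>t\<close> for \<open>u = p \<oplus> q\<close>, \<open>q\<close> and \<open>p\<close>. The
    \<open>u * t\<close> cancel by additivity, and \<open>r * a\<close> occurs twice with each
    sign.\<close>
  define t where "t = skb_lambda A r a"
  have t: "t \<in> carrier A"
    using assms pqr by (simp add: t_def)
  note closed = coset_star_closed [OF pqr(1) t] coset_star_closed [OF pqr(2) t]
    coset_star_closed [OF pqr(3) assms(2)]
  have "coset_star (right_distributor A p q r) a =
      (coset_star p t \<oplus>\<^bsub>rad_quot A\<^esub> coset_star q t) \<oplus>\<^bsub>rad_quot A\<^esub> coset_star r a
      \<ominus>\<^bsub>rad_quot A\<^esub> (coset_star q t \<oplus>\<^bsub>rad_quot A\<^esub> coset_star r a)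
      \<oplus>\<^bsub>rad_quot A\<^esub> coset_star r a
      \<ominus>\<^bsub>rad_quot A\<^esub> (coset_star p t \<oplus>\<^bsub>rad_quot A\<^esub> coset_star r a)"
    using pqr assms t
    by (simp add: right_distributor_def coset_star_diff_left coset_star_add_left
        coset_star_circ_left flip: t_def)
  also have "\<dots> = \<zero>\<^bsub>rad_quot A\<^esub>"
    using closed by algebra
  finally show "coset_star (right_distributor A p q r) a = \<zero>\<^bsub>rad_quot A\<^esub>" .
qed fact

lemma coset_star_radicalator_right:
  assumes "x \<in> radicalator A" "a \<in> carrier A"
  shows "coset_star a x = \<zero>\<^bsub>rad_quot A\<^esub>"
proof (rule hom_vanishes_on_radicalator [OF rad_quot_abelian coset_star_hom_right _ assms(1)])
  fix p q r assume pqr: "p \<in> carrier A" "q \<in> carrier A" "r \<in> carrier A"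
  have l: "skb_lambda A a p \<in> carrier A" "skb_lambda A a q \<in> carrier A"
    using assms pqr by simp_all
  note closed = pqr [THEN coset_star_closed [OF assms(2)]]
    coset_star_closed [OF pqr(1,3)] coset_star_closed [OF pqr(2,3)]
    coset_star_closed [OF l(1) pqr(3)] coset_star_closed [OF l(2) pqr(3)]
  \<comment> \<open>By \<open>coset_star_circ_right\<close>, \<open>a * (u \<otimes> r)\<close>
    consists of terms additive in \<open>u\<close>, which cancel over \<open>p \<oplus> q\<close>,
    \<open>q\<close> and \<open>p\<close>, and of \<open>a * r\<close>, which occurs twice with each
    sign.\<close>
  have "coset_star a (right_distributor A p q r) =
      (coset_star a p \<oplus>\<^bsub>rad_quot A\<^esub> coset_star a q) \<oplus>\<^bsub>rad_quot A\<^esub> coset_star a r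
        \<oplus>\<^bsub>rad_quot A\<^esub>
          (coset_star (skb_lambda A a p) r \<oplus>\<^bsub>rad_quot A\<^esub> coset_star (skb_lambda A a q) r)
        \<ominus>\<^bsub>rad_quot A\<^esub> (coset_star p r \<oplus>\<^bsub>rad_quot A\<^esub> coset_star q r)
      \<ominus>\<^bsub>rad_quot A\<^esub> (coset_star a q \<oplus>\<^bsub>rad_quot A\<^esub> coset_star a r
        \<oplus>\<^bsub>rad_quot A\<^esub> coset_star (skb_lambda A a q) r \<ominus>\<^bsub>rad_quot A\<^esub> coset_star q r)
      \<oplus>\<^bsub>rad_quot A\<^esub> coset_star a r
      \<ominus>\<^bsub>rad_quot A\<^esub> (coset_star a p \<oplus>\<^bsub>rad_quot A\<^esub> coset_star a r
        \<oplus>\<^bsub>rad_quot A\<^esub> coset_star (skb_lambda A a p) r \<ominus>\<^bsub>rad_quot A\<^esub> coset_star p r)"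
    using pqr assms
    by (simp add: right_distributor_def coset_star_diff_right coset_star_add_right
        coset_star_circ_right coset_star_add_left lambda_add)
  also have "\<dots> = \<zero>\<^bsub>rad_quot A\<^esub>"
    using closed by algebra
  finally show "coset_star a (right_distributor A p q r) = \<zero>\<^bsub>rad_quot A\<^esub>" .
qed fact

lemma radicalator_ideal: "skb_ideal (radicalator A) A"
  unfolding skb_ideal_def
proof (intro conjI ballI)
  fix a x assume a: "a \<in> carrier A" and x: "x \<in> radicalator A"
  then have "x \<in> carrier A"
    by simp
  with a show "skb_star A a x \<in> radicalator A" "skb_star A x a \<in> radicalator A"
    using coset_star_radicalator_right [OF x a] coset_star_radicalator_left [OF x a]
      coset_eq_zero_iff [OF star_closed] by (auto simp only: coset_star_def)
qed (rule radicalator_normal)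

section \<open>The circle operation on cosets, and the quotient as a radical ring\<close>

lemma coset_star_cong:
  assumes "x \<in> carrier A" "y \<in> carrier A" "x' \<in> carrier A" "y' \<in> carrier A"
    and "radicalator A +> x = radicalator A +> x'" "radicalator A +> y = radicalator A +> y'"
  shows "coset_star x y = coset_star x' y'"
proof -
  have diff: "u \<ominus> v \<in> radicalator A"
    if "u \<in> carrier A" "v \<in> carrier A" "radicalator A +> u = radicalator A +> v" for u v
  proof -
    have "radicalator A +> (u \<ominus> v) = \<zero>\<^bsub>rad_quot A\<^esub>"
      using that coset_diff Q.minus_eq_zero_iff coset_closed by metis
    then show ?thesis
      using that coset_eq_zero_iff minus_closed by blast
  qed
  \<comment> \<open>The arguments are exchanged one at a time; each exchange changes the class by
    star with an element of I, hence by zero.\<close>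
  have "coset_star (x \<ominus> x') y = \<zero>\<^bsub>rad_quot A\<^esub>"
    using coset_star_radicalator_left diff assms by blast
  then have "coset_star x y = coset_star x' y"
    using assms(1-4) coset_star_diff_left Q.minus_eq_zero_iff coset_star_closed by metis
  also have "coset_star x' (y \<ominus> y') = \<zero>\<^bsub>rad_quot A\<^esub>"
    using coset_star_radicalator_right diff assms by blast
  then have "coset_star x' y = coset_star x' y'"
    using assms(1-4) coset_star_diff_right Q.minus_eq_zero_iff coset_star_closed by metis
  finally show ?thesis .
qed

text \<open>The product in \<open>Quot\<close> is a union of the cosets of
  \<open>a \<otimes> b\<close> over all representatives; by \<open>coset_star_cong\<close> and
  \<open>coset_circ\<close> these cosets coincide.\<close>

lemma coset_mult:
  assumes "x \<in> carrier A" "y \<in> carrier A"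
  shows "(radicalator A +> x) \<otimes>\<^bsub>rad_quot A\<^esub> (radicalator A +> y) = radicalator A +> (x \<otimes> y)"
proof -
  have "radicalator A +> (a \<otimes> b) = radicalator A +> (x \<otimes> y)"
    if "a \<in> radicalator A +> x" "b \<in> radicalator A +> y" for a b
    using that assms coset_star_cong [of a b x y] by (simp add: in_coset_iff coset_circ)
  then have "(\<Union>a\<in>radicalator A +> x. \<Union>b\<in>radicalator A +> y. radicalator A +> (a \<otimes> b))
      = radicalator A +> (x \<otimes> y)"
    using assms [THEN coset_self] by blast
  then show ?thesis
    by (simp add: rad_quot_def FactRing_def rcoset_mult_def)
qed

text \<open>Both sides expand to \<open>x + y + x * z + y * z + z\<close> in the quotient.\<close>

lemma coset_circ_right_distrib:
  assumes "x \<in> carrier A" "y \<in> carrier A" "z \<in> carrier A"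
  shows "radicalator A +> ((x \<oplus> y) \<otimes> z) = radicalator A +> (x \<otimes> z \<ominus> z \<oplus> y \<otimes> z)"
proof -
  note closed = assms [THEN coset_closed]
    coset_star_closed [OF assms(1,3)] coset_star_closed [OF assms(2,3)]
  have "radicalator A +> ((x \<oplus> y) \<otimes> z) =
      (radicalator A +> x) \<oplus>\<^bsub>rad_quot A\<^esub> (radicalator A +> y) \<oplus>\<^bsub>rad_quot A\<^esub>
        ((coset_star x z \<oplus>\<^bsub>rad_quot A\<^esub> coset_star y z) \<oplus>\<^bsub>rad_quot A\<^esub> (radicalator A +> z))"
    using assms by (simp add: coset_circ coset_add coset_star_add_left)
  also have "\<dots> = ((radicalator A +> x) \<oplus>\<^bsub>rad_quot A\<^esub>
        (coset_star x z \<oplus>\<^bsub>rad_quot A\<^esub> (radicalator A +> z))) \<ominus>\<^bsub>rad_quot A\<^esub> (radicalator A +> z)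
      \<oplus>\<^bsub>rad_quot A\<^esub> ((radicalator A +> y) \<oplus>\<^bsub>rad_quot A\<^esub>
        (coset_star y z \<oplus>\<^bsub>rad_quot A\<^esub> (radicalator A +> z)))"
    using closed by algebra
  also have "\<dots> = radicalator A +> (x \<otimes> z \<ominus> z \<oplus> y \<otimes> z)"
    using assms by (simp add: coset_circ coset_add coset_diff)
  finally show ?thesis .
qed

text \<open>The circle group and the brace axiom descend from \<open>A\<close> through
  representatives; right distributivity holds only modulo I and comes from
  \<open>coset_circ_right_distrib\<close>.\<close>

lemma rad_quot_radical_ring: "radical_ring (rad_quot A)"
proof -
  have elim: "\<exists>x\<in>carrier A. X = radicalator A +> x" if "X \<in> carrier (rad_quot A)" for X
    using that by (auto simp: rad_quot_simps)
  have "group (rad_quot A)"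
  proof (rule groupI)
    fix X assume "X \<in> carrier (rad_quot A)"
    then obtain x where x: "x \<in> carrier A" "X = radicalator A +> x"
      using elim by blast
    then have "(radicalator A +> inv x) \<otimes>\<^bsub>rad_quot A\<^esub> X = \<one>\<^bsub>rad_quot A\<^esub>"
      by (simp add: coset_mult rad_quot_simps)
    then show "\<exists>Y\<in>carrier (rad_quot A). Y \<otimes>\<^bsub>rad_quot A\<^esub> X = \<one>\<^bsub>rad_quot A\<^esub>"
      using x by blast
  qed (auto dest!: elim simp: coset_mult circ.m_assoc rad_quot_simps(3))
  moreover have "X \<otimes>\<^bsub>rad_quot A\<^esub> (Y \<oplus>\<^bsub>rad_quot A\<^esub> Z)
      = X \<otimes>\<^bsub>rad_quot A\<^esub> Y \<ominus>\<^bsub>rad_quot A\<^esub> X \<oplus>\<^bsub>rad_quot A\<^esub> X \<otimes>\<^bsub>rad_quot A\<^esub> Z"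
    "(X \<oplus>\<^bsub>rad_quot A\<^esub> Y) \<otimes>\<^bsub>rad_quot A\<^esub> Z
      = X \<otimes>\<^bsub>rad_quot A\<^esub> Z \<ominus>\<^bsub>rad_quot A\<^esub> Z \<oplus>\<^bsub>rad_quot A\<^esub> Y \<otimes>\<^bsub>rad_quot A\<^esub> Z"
    if XYZ: "X \<in> carrier (rad_quot A)" "Y \<in> carrier (rad_quot A)" "Z \<in> carrier (rad_quot A)"
    for X Y Z
  proof -
    obtain x y z where "x \<in> carrier A" "y \<in> carrier A" "z \<in> carrier A"
      and "X = radicalator A +> x" "Y = radicalator A +> y" "Z = radicalator A +> z"
      using XYZ [THEN elim] by blast
    then show "X \<otimes>\<^bsub>rad_quot A\<^esub> (Y \<oplus>\<^bsub>rad_quot A\<^esub> Z)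
      = X \<otimes>\<^bsub>rad_quot A\<^esub> Y \<ominus>\<^bsub>rad_quot A\<^esub> X \<oplus>\<^bsub>rad_quot A\<^esub> X \<otimes>\<^bsub>rad_quot A\<^esub> Z"
    "(X \<oplus>\<^bsub>rad_quot A\<^esub> Y) \<otimes>\<^bsub>rad_quot A\<^esub> Z
      = X \<otimes>\<^bsub>rad_quot A\<^esub> Z \<ominus>\<^bsub>rad_quot A\<^esub> Z \<oplus>\<^bsub>rad_quot A\<^esub> Y \<otimes>\<^bsub>rad_quot A\<^esub> Z"
      by (simp_all add: coset_mult coset_circ_right_distrib brace_distrib
          flip: coset_add coset_diff)
  qed
  ultimately show ?thesis
    by (intro radical_ring.intro skew_brace.intro radical_ring_axioms.intro Q.a_group Q.a_comm)
qed

lemma rad_proj_apply [simp]: "x \<in> carrier A \<Longrightarrow> rad_proj A x = radicalator A +> x"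
  by (simp add: rad_proj_def)

lemma rad_proj_hom: "rad_proj A \<in> skb_hom A (rad_quot A)"
  by (auto simp: skb_hom_def hom_def coset_add coset_mult) (simp add: rad_proj_def)

text \<open>The source of all uniqueness claims below: the coset map is onto, and off the carrier
  both maps are \<open>undefined\<close>.\<close>

lemma rad_quot_funcset_eqI:
  assumes "g \<in> extensional (carrier (rad_quot A))" "h \<in> extensional (carrier (rad_quot A))"
    and "\<And>x. x \<in> carrier A \<Longrightarrow> g (radicalator A +> x) = h (radicalator A +> x)"
  shows "g = h"
  using assms(1,2) by (rule extensionalityI) (auto simp: rad_quot_simps assms(3))

end

section \<open>Homomorphisms into radical rings and their lifts to the quotient\<close>

sublocale radical_ring < abelian_group A
  by (rule comm_group_abelian_groupI, rule group.group_comm_groupI [OF add_group])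
    (simp add: add_comm)

lemma skb_homD:
  assumes "f \<in> skb_hom A B"
  shows "\<And>x. x \<in> carrier A \<Longrightarrow> f x \<in> carrier B"
    and "\<And>x y. \<lbrakk>x \<in> carrier A; y \<in> carrier A\<rbrakk> \<Longrightarrow> f (x \<oplus>\<^bsub>A\<^esub> y) = f x \<oplus>\<^bsub>B\<^esub> f y"
    and "\<And>x y. \<lbrakk>x \<in> carrier A; y \<in> carrier A\<rbrakk> \<Longrightarrow> f (x \<otimes>\<^bsub>A\<^esub> y) = f x \<otimes>\<^bsub>B\<^esub> f y"
    and "f \<in> extensional (carrier A)"
  using assms by (auto simp: skb_hom_def hom_def)

text \<open>The group hypotheses keep sums and products inside \<open>carrier A\<close>, where
  \<open>compose\<close> is the true composite.\<close>

lemma skb_hom_compose: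
  "\<lbrakk>f \<in> skb_hom A B; g \<in> skb_hom B C; group A; group (add_monoid A)\<rbrakk>
    \<Longrightarrow> compose (carrier A) g f \<in> skb_hom A C"
  by (auto simp: skb_hom_def hom_def compose_def Pi_iff group.is_monoid
      monoid.m_closed [of "add_monoid A", simplified] monoid.m_closed [of A])

text \<open>Right distributivity in \<open>R\<close> expands the image of a right distributor into
  terms that cancel; the vanishing criterion does the rest.\<close>

lemma skb_hom_radical_ring_vanishes:
  assumes "skew_brace A" "radical_ring R" and f: "f \<in> skb_hom A R" and "x \<in> radicalator A"
  shows "f x = \<zero>\<^bsub>R\<^esub>"
proof -
  interpret A: skew_brace A by fact
  interpret R: radical_ring R by fact
  note hom = skb_homD [OF f]
  have hom_add: "f \<in> hom (add_monoid A) (add_monoid R)"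
    using f by (simp add: skb_hom_def)
  then have f_inv: "f (\<ominus>\<^bsub>A\<^esub> y) = \<ominus>\<^bsub>R\<^esub> f y" if "y \<in> carrier A" for y
    using group_hom.hom_inv [of "add_monoid A" "add_monoid R" f y] that A.add_group R.a_group
    by (simp add: group_hom_def group_hom_axioms_def a_inv_def)
  have "f (right_distributor A a b c) = \<zero>\<^bsub>R\<^esub>"
    if abc: "a \<in> carrier A" "b \<in> carrier A" "c \<in> carrier A" for a b c
  proof -
    have closed: "f c \<in> carrier R" "f a \<otimes>\<^bsub>R\<^esub> f c \<in> carrier R" "f b \<otimes>\<^bsub>R\<^esub> f c \<in> carrier R"
      using abc by (simp_all add: hom)
    have "f (right_distributor A a b c) =
        (f a \<otimes>\<^bsub>R\<^esub> f c \<ominus>\<^bsub>R\<^esub> f c \<oplus>\<^bsub>R\<^esub> f b \<otimes>\<^bsub>R\<^esub> f c)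
          \<ominus>\<^bsub>R\<^esub> f b \<otimes>\<^bsub>R\<^esub> f c \<oplus>\<^bsub>R\<^esub> f c \<ominus>\<^bsub>R\<^esub> f a \<otimes>\<^bsub>R\<^esub> f c"
      using abc by (simp add: right_distributor_def a_minus_def hom f_inv
          R.right_distrib [unfolded a_minus_def])
    also have "\<dots> = \<zero>\<^bsub>R\<^esub>"
      using closed by algebra
    finally show ?thesis .
  qed
  then show ?thesis
    using A.hom_vanishes_on_radicalator [OF R.abelian_group_axioms hom_add] assms(4) by blast
qed

text \<open>A homomorphism into a radical ring is constant on each coset, so the image is a
  singleton and \<open>the_elem\<close> reads off its value; \<open>rad_map\<close> has the same
  form.\<close>

definition rad_lift :: "('a, 'm) ring_scheme \<Rightarrow> ('a \<Rightarrow> 'r) \<Rightarrow> 'a set \<Rightarrow> 'r" where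
  "rad_lift A f = (\<lambda>X\<in>carrier (rad_quot A). the_elem (f ` X))"

lemma rad_lift_extensional: "rad_lift A f \<in> extensional (carrier (rad_quot A))"
  by (simp add: rad_lift_def)

lemma rad_lift_coset:
  assumes "skew_brace A" "radical_ring R" and f: "f \<in> skb_hom A R" and x: "x \<in> carrier A"
  shows "rad_lift A f (radicalator A +>\<^bsub>A\<^esub> x) = f x"
proof -
  interpret A: skew_brace A by fact
  interpret R: radical_ring R by fact
  note hom = skb_homD [OF f]
  have "f y = f x" if y: "y \<in> radicalator A +>\<^bsub>A\<^esub> x" for y
  proof -
    obtain i where "i \<in> radicalator A" "y = i \<oplus>\<^bsub>A\<^esub> x"
      using y unfolding a_r_coset_def' by blast
    then show ?thesis
      using x skb_hom_radical_ring_vanishes [OF assms(1-3)] by (simp add: hom)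
  qed
  \<comment> \<open>The coset contains \<open>x\<close>, so the image is not empty.\<close>
  then have "f ` (radicalator A +>\<^bsub>A\<^esub> x) = {f x}"
    using A.coset_self [OF x] by blast
  then show ?thesis
    using x by (simp add: rad_lift_def)
qed

lemma rad_lift_hom:
  assumes "skew_brace A" "radical_ring R" and f: "f \<in> skb_hom A R"
  shows "rad_lift A f \<in> skb_hom (rad_quot A) R"
proof -
  interpret A: skew_brace A by fact
  note hom = skb_homD [OF f]
  note lift = rad_lift_coset [OF assms]
  have "rad_lift A f (X \<oplus>\<^bsub>rad_quot A\<^esub> Y) = rad_lift A f X \<oplus>\<^bsub>R\<^esub> rad_lift A f Y"
    "rad_lift A f (X \<otimes>\<^bsub>rad_quot A\<^esub> Y) = rad_lift A f X \<otimes>\<^bsub>R\<^esub> rad_lift A f Y"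
    "rad_lift A f X \<in> carrier R"
    if XY: "X \<in> carrier (rad_quot A)" "Y \<in> carrier (rad_quot A)" for X Y
  proof -
    obtain x y where "x \<in> carrier A" "y \<in> carrier A"
      and "X = radicalator A +>\<^bsub>A\<^esub> x" "Y = radicalator A +>\<^bsub>A\<^esub> y"
      using XY unfolding A.rad_quot_simps(1) by blast
    then show "rad_lift A f (X \<oplus>\<^bsub>rad_quot A\<^esub> Y) = rad_lift A f X \<oplus>\<^bsub>R\<^esub> rad_lift A f Y"
      "rad_lift A f (X \<otimes>\<^bsub>rad_quot A\<^esub> Y) = rad_lift A f X \<otimes>\<^bsub>R\<^esub> rad_lift A f Y"
      "rad_lift A f X \<in> carrier R"
      by (simp_all add: A.coset_mult lift hom flip: A.coset_add)
  qed
  then show ?thesis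
    unfolding skb_hom_def hom_def by (auto simp: rad_lift_extensional)
qed

text \<open>Composing with the projection amounts to evaluating on cosets, which determines
  \<open>g\<close>. The equivalence yields existence and uniqueness of the factorization at
  once.\<close>

lemma rad_lift_unique:
  assumes "skew_brace A" "radical_ring R" and f: "f \<in> skb_hom A R"
    and g: "g \<in> skb_hom (rad_quot A) R"
  shows "compose (carrier A) g (rad_proj A) = f \<longleftrightarrow> g = rad_lift A f"
proof -
  interpret A: skew_brace A by fact
  note lift = rad_lift_coset [OF assms(1-3)]
  show ?thesis
  proof
    assume "compose (carrier A) g (rad_proj A) = f"
    then have "g (radicalator A +>\<^bsub>A\<^esub> x) = f x" if "x \<in> carrier A" for x
      using that by (auto simp: compose_def)
    then show "g = rad_lift A f"
      using skb_homD(4) [OF g] by (intro A.rad_quot_funcset_eqI rad_lift_extensional) (auto simp: lift)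
  next
    assume "g = rad_lift A f"
    then show "compose (carrier A) g (rad_proj A) = f"
      using skb_homD(4) [OF f] by (intro extensionalityI [of _ "carrier A"]) (auto simp: lift compose_def)
  qed
qed

section \<open>Induced maps, transposes and the adjunction\<close>

lemma rad_map_eq_rad_lift:
  assumes "skew_brace A" and f: "f \<in> skb_hom A B"
  shows "rad_map A B f = rad_lift A (compose (carrier A) (rad_proj B) f)"
proof -
  interpret A: skew_brace A by fact
  \<comment> \<open>On \<open>carrier A\<close> the extensional composite agrees with
    \<open>rad_proj B (f x)\<close>, so both definitions take the same image of
    \<open>X\<close>.\<close>
  have "X \<subseteq> carrier A" if "X \<in> carrier (rad_quot A)" for X
    using that by (auto simp: A.rad_quot_simps A.in_coset_iff)
  then show ?thesis
    unfolding rad_map_def rad_lift_def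
    by (intro restrict_ext arg_cong [where f = the_elem] image_cong) (auto simp: compose_def)
qed

text \<open>The quotient of \<open>B\<close> is a radical ring, so the results on
  \<open>rad_lift\<close> apply to the composite of \<open>f\<close> with the projection of
  \<open>B\<close>.\<close>

lemma rad_map_hom:
  assumes "skew_brace A" "skew_brace B" and f: "f \<in> skb_hom A B"
  shows "rad_map A B f \<in> skb_hom (rad_quot A) (rad_quot B)"
    and "x \<in> carrier A \<Longrightarrow> rad_map A B f (radicalator A +>\<^bsub>A\<^esub> x) = radicalator B +>\<^bsub>B\<^esub> f x"
proof -
  interpret A: skew_brace A by fact
  interpret B: skew_brace B by fact
  have "compose (carrier A) (rad_proj B) f \<in> skb_hom A (rad_quot B)"
    using skb_hom_compose [OF f B.rad_proj_hom A.circ_group A.add_group] .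
  note lift = assms(1) B.rad_quot_radical_ring this
  show "rad_map A B f \<in> skb_hom (rad_quot A) (rad_quot B)"
    using rad_lift_hom [OF lift] by (simp add: rad_map_eq_rad_lift [OF assms(1) f])
  show "rad_map A B f (radicalator A +>\<^bsub>A\<^esub> x) = radicalator B +>\<^bsub>B\<^esub> f x" if "x \<in> carrier A"
    using rad_lift_coset [OF lift that] that skb_homD(1) [OF f]
    by (simp add: rad_map_eq_rad_lift [OF assms(1) f] compose_def)
qed

lemma skb_id_hom: "skew_brace A \<Longrightarrow> skb_id A \<in> skb_hom A A"
proof -
  assume "skew_brace A"
  then interpret skew_brace A .
  show ?thesis
    by (auto simp: skb_id_def skb_hom_def hom_def)
qed

text \<open>The inverse is \<open>rad_lift A\<close>, by the two directions of
  \<open>rad_lift_unique\<close>.\<close>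

lemma rad_transpose_bij:
  assumes "skew_brace A" "radical_ring R"
  shows "bij_betw (rad_transpose A) (skb_hom (rad_quot A) R) (skb_hom A R)"
proof (rule bij_betw_byWitness [where f' = "rad_lift A"])
  interpret A: skew_brace A by fact
  have in_hom: "rad_transpose A g \<in> skb_hom A R" if "g \<in> skb_hom (rad_quot A) R" for g
    using skb_hom_compose [OF A.rad_proj_hom that A.circ_group A.add_group]
    by (simp add: rad_transpose_def)
  then show "rad_transpose A ` skb_hom (rad_quot A) R \<subseteq> skb_hom A R"
    by blast
  show "rad_lift A ` skb_hom A R \<subseteq> skb_hom (rad_quot A) R"
    using rad_lift_hom [OF assms] by blast
  show "\<forall>g\<in>skb_hom (rad_quot A) R. rad_lift A (rad_transpose A g) = g"
    using rad_lift_unique [OF assms in_hom] by (metis rad_transpose_def)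
  show "\<forall>f\<in>skb_hom A R. rad_transpose A (rad_lift A f) = f"
    using rad_lift_unique [OF assms] rad_lift_hom [OF assms] by (metis rad_transpose_def)
qed

theorem mainTheorem5:
  fixes A :: "'a ring" and B :: "'b ring" and C :: "'c ring"
    and R :: "'r ring" and S :: "'s ring"
  assumes "skew_brace A" and "skew_brace B" and "skew_brace C"
    and "radical_ring R" and "radical_ring S"
  shows
   "
    \<comment> \<open>the quotient is by an ideal, and is a radical ring\<close>
    (skb_ideal (radicalator A) A \<and> radical_ring (rad_quot A)) \<and>
    \<comment> \<open>the induced maps make the quotient a functor\<close>
    (\<forall>f\<in>skb_hom A B. rad_map A B f \<in> skb_hom (rad_quot A) (rad_quot B) \<and>
       (\<forall>x\<in>carrier A. rad_map A B f (rad_proj A x) = rad_proj B (f x))) \<and>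
    (rad_map A A (skb_id A) = skb_id (rad_quot A)) \<and>
    (\<forall>f\<in>skb_hom A B. \<forall>g\<in>skb_hom B C.
       rad_map A C (compose (carrier A) g f)
         = compose (carrier (rad_quot A)) (rad_map B C g) (rad_map A B f)) \<and>
    \<comment> \<open>the canonical map is a natural transformation from the identity\<close>
    (rad_proj A \<in> skb_hom A (rad_quot A)) \<and>
    (\<forall>f\<in>skb_hom A B.
       compose (carrier A) (rad_map A B f) (rad_proj A)
         = compose (carrier A) (rad_proj B) f) \<and>
    \<comment> \<open>the adjunction: a bijection of hom-sets, natural in both arguments, with this unit\<close>
    (bij_betw (rad_transpose A) (skb_hom (rad_quot A) R) (skb_hom A R)) \<and>
    (\<forall>f\<in>skb_hom A B. \<forall>g\<in>skb_hom (rad_quot B) R.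
       rad_transpose A (compose (carrier (rad_quot A)) g (rad_map A B f))
         = compose (carrier A) (rad_transpose B g) f) \<and>
    (\<forall>g\<in>skb_hom (rad_quot A) R. \<forall>h\<in>skb_hom R S.
       rad_transpose A (compose (carrier (rad_quot A)) h g)
         = compose (carrier A) h (rad_transpose A g)) \<and>
    (rad_transpose A (skb_id (rad_quot A)) = rad_proj A) \<and>
    \<comment> \<open>the universal property\<close>
    (\<forall>f\<in>skb_hom A R. \<exists>!g. g \<in> skb_hom (rad_quot A) R \<and> compose (carrier A) g (rad_proj A) = f)"
proof (intro conjI ballI)
  interpret A: skew_brace A by fact
  interpret B: skew_brace B by fact
  interpret C: skew_brace C by fact
  note map_hom = rad_map_hom(1) [OF assms(1,2)] and map_coset = rad_map_hom(2) [OF assms(1,2)]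
  note map_coset' = rad_map_hom(2) [OF assms(2,3)]
  show "skb_ideal (radicalator A) A" "radical_ring (rad_quot A)"
    by (rule A.radicalator_ideal A.rad_quot_radical_ring)+
  show "rad_proj A \<in> skb_hom A (rad_quot A)"
    by (rule A.rad_proj_hom)
  show "bij_betw (rad_transpose A) (skb_hom (rad_quot A) R) (skb_hom A R)"
    by (rule rad_transpose_bij [OF assms(1,4)])
  show "rad_map A A (skb_id A) = skb_id (rad_quot A)"
  \<comment> \<open>Both sides fix the coset of every \<open>x\<close>.\<close>
  proof (rule A.rad_quot_funcset_eqI)
    fix x assume "x \<in> carrier A"
    then show "rad_map A A (skb_id A) (radicalator A +>\<^bsub>A\<^esub> x)
        = skb_id (rad_quot A) (radicalator A +>\<^bsub>A\<^esub> x)"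
      using rad_map_hom(2) [OF assms(1,1) skb_id_hom] assms(1) by (simp add: skb_id_def)
  qed (simp_all add: rad_map_def skb_id_def)
  show "rad_transpose A (skb_id (rad_quot A)) = rad_proj A"
    by (auto simp: rad_transpose_def compose_def skb_id_def rad_proj_def restrict_def fun_eq_iff)
  fix f assume f: "f \<in> skb_hom A B"
  note f_closed = skb_homD(1) [OF f]
  show "rad_map A B f \<in> skb_hom (rad_quot A) (rad_quot B)"
    by (rule map_hom [OF f])
  show "rad_map A B f (rad_proj A x) = rad_proj B (f x)" if "x \<in> carrier A" for x
    using that by (simp add: map_coset [OF f] f_closed)
  then show "compose (carrier A) (rad_map A B f) (rad_proj A) = compose (carrier A) (rad_proj B) f"
    unfolding compose_def by (intro restrict_ext)
  show "rad_map A C (compose (carrier A) g f)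
      = compose (carrier (rad_quot A)) (rad_map B C g) (rad_map A B f)"
    if g: "g \<in> skb_hom B C" for g
  \<comment> \<open>Both sides send the coset of \<open>x\<close> to the coset of
    \<open>g (f x)\<close>.\<close>
  proof (rule A.rad_quot_funcset_eqI)
    note gf = skb_hom_compose [OF f g A.circ_group A.add_group]
    fix x assume "x \<in> carrier A"
    then show "rad_map A C (compose (carrier A) g f) (radicalator A +>\<^bsub>A\<^esub> x)
        = compose (carrier (rad_quot A)) (rad_map B C g) (rad_map A B f) (radicalator A +>\<^bsub>A\<^esub> x)"
      using rad_map_hom(2) [OF assms(1,3) gf, of x]
      by (simp add: map_coset [OF f] map_coset' [OF g] f_closed compose_def)
  qed (simp_all add: rad_map_def)
  \<comment> \<open>Naturality in the skew brace: both sides send \<open>x\<close> to the value of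
    \<open>g\<close> at the class of \<open>f x\<close>.\<close>
  show "rad_transpose A (compose (carrier (rad_quot A)) g (rad_map A B f))
      = compose (carrier A) (rad_transpose B g) f" for g
    by (auto simp: rad_transpose_def compose_def map_coset [OF f] f_closed)
next
  interpret A: skew_brace A by fact
  \<comment> \<open>Naturality in the radical ring is associativity of composition.\<close>
  show "rad_transpose A (compose (carrier (rad_quot A)) h g)
      = compose (carrier A) h (rad_transpose A g)" for g h
    by (auto simp: rad_transpose_def compose_def)
next
  fix f assume "f \<in> skb_hom A R"
  then show "\<exists>!g. g \<in> skb_hom (rad_quot A) R \<and> compose (carrier A) g (rad_proj A) = f"
    using rad_lift_unique [OF assms(1,4)] rad_lift_hom [OF assms(1,4)] by metis
qed

end
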